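(* Let $(G,+,0,\le_G)$ be an ordered group and let $\vdash$ be a regular entailment relation for $G$. Let $H$ be the distributive lattice generated by $\vdash$, with natural map $\iota\colon G\to H$. Then there is a unique group law on $H$ which is compatible with its lattice structure and such that $\iota$ is a group morphism. (With this law $H$ is a lattice-ordered group, called the group of ideals associated with $\vdash$.)
   Context: All monoids and groups are commutative; orders are partial. An ordered group is a commutative group $(G,+,0)$ with a partial order $\le_G$ such that $x\le_G y$ implies $x+z\le_G y+z$. For a set $G$, let $\mathrm{P}_{\mathrm{fe}}^*(G)$ be the set of nonempty finite subsets of $G$; we write $a$ for $\{a\}$, $A,A'$ for $A\cup A'$, and $x+A=\{x+a:a\in A\}$. An unbounded entailment relation on $G$ is a binary relation $\vdash$ on $\mathrm{P}_{\mathrm{fe}}^*(G)$ such that: $a\vdash a$; if $A\vdash B$ then $A,A'\vdash B,B'$; if $A\vdash B,c$ and $A,c\vdash B$ then $A\vdash B$. It is equivariant (for the ordered group $G$) if moreover $a\le_G b$ implies $a\vdash b$, and $A\vdash B$ implies $x+A\vdash x+B$ for all $x\in G$. It is regular if it is equivariant and $x+a,\,y+b\vdash y+a,\,x+b$ for all $a,b,x,y\in G$. The distributive lattice generated by $\vdash$ is the distributive lattice (not required to have a top or bottom) presented by generators the elements of $G$ and relations $\bigwedge A\le\bigvee B$ whenever $A\vdash B$; $\iota$ sends $a\in G$ to its generator. A group law $+$ on a lattice is compatible with the lattice structure if $x+(y\wedge z)=(x+y)\wedge(x+z)$ and $x+(y\vee z)=(x+y)\vee(x+z)$. *)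

theory Defs
  imports "HOL-Algebra.Group" "HOL-Algebra.Lattice" "HOL-Library.FuncSet"
begin

section \<open>Entailment relations\<close>

text \<open>Ordered groups are the types of class \<^class>\<open>ordered_ab_group_add\<close>: commutative
  groups with a translation-invariant partial order.\<close>

definition Pfe :: "'a set set" where
  "Pfe = {A. finite A \<and> A \<noteq> {}}"

text \<open>A relation on nonempty finite sets is rendered as a predicate on all sets that holds
  only for pairs of nonempty finite ones (assumption \<open>dom\<close>).\<close>

locale unbounded_entailment =
  fixes entails :: "'a set \<Rightarrow> 'a set \<Rightarrow> bool"  (infix \<open>\<turnstile>\<close> 50)
  assumes dom: "A \<turnstile> B \<Longrightarrow> A \<in> Pfe \<and> B \<in> Pfe"
    and refl: "{a} \<turnstile> {a}"
    and weakening: "\<lbrakk>A \<turnstile> B; A' \<in> Pfe; B' \<in> Pfe\<rbrakk> \<Longrightarrow> A \<union> A' \<turnstile> B \<union> B'"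
    and cut: "\<lbrakk>A \<in> Pfe; B \<in> Pfe; A \<turnstile> B \<union> {c}; A \<union> {c} \<turnstile> B\<rbrakk> \<Longrightarrow> A \<turnstile> B"

locale equivariant_entailment = unbounded_entailment entails
  for entails :: "'a::ordered_ab_group_add set \<Rightarrow> 'a set \<Rightarrow> bool"  (infix \<open>\<turnstile>\<close> 50) +
  assumes order: "a \<le> b \<Longrightarrow> {a} \<turnstile> {b}"
    and translation: "A \<turnstile> B \<Longrightarrow> (+) x ` A \<turnstile> (+) x ` B"

locale regular_entailment = equivariant_entailment +
  assumes regularity: "{x + a, y + b} \<turnstile> {y + a, x + b}"


section \<open>The distributive lattice generated by an entailment relation\<close>

locale distributive_lattice = lattice +
  assumes meet_join_distrib:
    "\<lbrakk>x \<in> carrier L; y \<in> carrier L; z \<in> carrier L\<rbrakk>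
      \<Longrightarrow> x \<sqinter> (y \<squnion> z) = (x \<sqinter> y) \<squnion> (x \<sqinter> z)"

datatype 'a lterm = Gen 'a | Meet "'a lterm" "'a lterm" | Join "'a lterm" "'a lterm"

text \<open>The meet and join of the generators in the nonempty list \<open>a # as\<close>.\<close>

definition gens_meet :: "'a \<Rightarrow> 'a list \<Rightarrow> 'a lterm" where
  "gens_meet a as = foldr (\<lambda>b. Meet (Gen b)) as (Gen a)"

definition gens_join :: "'a \<Rightarrow> 'a list \<Rightarrow> 'a lterm" where
  "gens_join a as = foldr (\<lambda>b. Join (Gen b)) as (Gen a)"

text \<open>The least preorder on lattice terms that makes \<^const>\<open>Meet\<close> and \<^const>\<open>Join\<close> binary
  infima and suprema, is distributive, and satisfies the relations. In the rule \<open>relation\<close>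
  the finite sets are given by arbitrary enumerations, with repetitions allowed.\<close>

inductive lterm_le :: "('a set \<Rightarrow> 'a set \<Rightarrow> bool) \<Rightarrow> 'a lterm \<Rightarrow> 'a lterm \<Rightarrow> bool"
  for entails (infix \<open>\<turnstile>\<close> 50) where
  le_refl: "lterm_le entails s s"
| le_trans: "\<lbrakk>lterm_le entails s t; lterm_le entails t u\<rbrakk> \<Longrightarrow> lterm_le entails s u"
| meet1: "lterm_le entails (Meet s t) s"
| meet2: "lterm_le entails (Meet s t) t"
| meet_greatest: "\<lbrakk>lterm_le entails u s; lterm_le entails u t\<rbrakk> \<Longrightarrow> lterm_le entails u (Meet s t)"
| join1: "lterm_le entails s (Join s t)"
| join2: "lterm_le entails t (Join s t)"
| join_least: "\<lbrakk>lterm_le entails s u; lterm_le entails t u\<rbrakk> \<Longrightarrow> lterm_le entails (Join s t) u"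
| distrib: "lterm_le entails (Meet s (Join t u)) (Join (Meet s t) (Meet s u))"
| relation: "set (a # as) \<turnstile> set (b # bs)
    \<Longrightarrow> lterm_le entails (gens_meet a as) (gens_join b bs)"

definition lterm_eq :: "('a set \<Rightarrow> 'a set \<Rightarrow> bool) \<Rightarrow> ('a lterm \<times> 'a lterm) set" where
  "lterm_eq entails = {(s, t). lterm_le entails s t \<and> lterm_le entails t s}"

definition generated_lattice :: "('a set \<Rightarrow> 'a set \<Rightarrow> bool) \<Rightarrow> 'a lterm set gorder" where
  "generated_lattice entails =
    \<lparr>carrier = UNIV // lterm_eq entails, eq = (=),
     le = (\<lambda>X Y. \<exists>s\<in>X. \<exists>t\<in>Y. lterm_le entails s t)\<rparr>"

definition lclass :: "('a set \<Rightarrow> 'a set \<Rightarrow> bool) \<Rightarrow> 'a lterm \<Rightarrow> 'a lterm set" where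
  "lclass entails s = lterm_eq entails `` {s}"

definition iota :: "('a set \<Rightarrow> 'a set \<Rightarrow> bool) \<Rightarrow> 'a \<Rightarrow> 'a lterm set" where
  "iota entails a = lclass entails (Gen a)"

lemma equiv_lterm_eq: "equiv UNIV (lterm_eq entails)"
proof (rule equivI)
  show "trans (lterm_eq entails)"
    unfolding trans_def lterm_eq_def using lterm_le.le_trans[of entails] by blast
qed (auto simp: lterm_eq_def refl_on_def sym_def intro: lterm_le.le_refl)

lemma lclass_self: "s \<in> lclass entails s"
  by (auto simp: lclass_def lterm_eq_def intro: lterm_le.le_refl)

lemma carrier_generated_lattice:
  "carrier (generated_lattice entails) = range (lclass entails)"
  by (auto simp: generated_lattice_def quotient_def lclass_def)

lemma lclass_closed: "lclass entails s \<in> carrier (generated_lattice entails)"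
  by (simp add: carrier_generated_lattice)

lemma iota_closed: "iota entails a \<in> carrier (generated_lattice entails)"
  by (simp add: iota_def lclass_closed)

lemma eq_generated_lattice: "eq (generated_lattice entails) = (=)"
  by (simp add: generated_lattice_def)

lemma lclass_le_iff:
  "lclass entails s \<sqsubseteq>\<^bsub>generated_lattice entails\<^esub> lclass entails t \<longleftrightarrow> lterm_le entails s t"
proof
  assume "lclass entails s \<sqsubseteq>\<^bsub>generated_lattice entails\<^esub> lclass entails t"
  then obtain s' t' where "lterm_le entails s s'" "lterm_le entails s' t'" "lterm_le entails t' t"
    by (auto simp: generated_lattice_def lclass_def lterm_eq_def)
  then show "lterm_le entails s t" by (meson lterm_le.le_trans)
next
  assume "lterm_le entails s t"
  then show "lclass entails s \<sqsubseteq>\<^bsub>generated_lattice entails\<^esub> lclass entails t"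
    using lclass_self by (auto simp: generated_lattice_def)
qed

lemma lclass_eq_iff:
  "lclass entails s = lclass entails t \<longleftrightarrow> lterm_le entails s t \<and> lterm_le entails t s"
  unfolding lclass_def using eq_equiv_class_iff[OF equiv_lterm_eq, of s t entails]
  by (simp add: lterm_eq_def)

lemma partial_order_generated_lattice: "partial_order (generated_lattice entails)"
proof
  fix x y z w
  assume "x .=\<^bsub>generated_lattice entails\<^esub> y" "z .=\<^bsub>generated_lattice entails\<^esub> w"
  then show "x \<sqsubseteq>\<^bsub>generated_lattice entails\<^esub> z \<longleftrightarrow> y \<sqsubseteq>\<^bsub>generated_lattice entails\<^esub> w"
    by (simp add: eq_generated_lattice)
next
  fix x y z
  assume "x \<sqsubseteq>\<^bsub>generated_lattice entails\<^esub> y" "y \<sqsubseteq>\<^bsub>generated_lattice entails\<^esub> z"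
    "x \<in> carrier (generated_lattice entails)" "y \<in> carrier (generated_lattice entails)"
    "z \<in> carrier (generated_lattice entails)"
  then show "x \<sqsubseteq>\<^bsub>generated_lattice entails\<^esub> z"
    by (auto simp: carrier_generated_lattice lclass_le_iff) (meson lterm_le.le_trans)
qed (auto simp: eq_generated_lattice carrier_generated_lattice lclass_le_iff
      intro!: lclass_eq_iff[THEN iffD2] intro: lterm_le.le_refl)

lemma least_lclass_Join:
  "least (generated_lattice entails) (lclass entails (Join s t))
     (Upper (generated_lattice entails) {lclass entails s, lclass entails t})"
proof (rule least_UpperI)
  fix x assume "x \<in> {lclass entails s, lclass entails t}"
  then show "x \<sqsubseteq>\<^bsub>generated_lattice entails\<^esub> lclass entails (Join s t)"
    using lterm_le.join1 lterm_le.join2 lclass_le_iff by (metis insert_iff singletonD)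
next
  fix y assume y: "y \<in> Upper (generated_lattice entails) {lclass entails s, lclass entails t}"
  then have le: "lclass entails s \<sqsubseteq>\<^bsub>generated_lattice entails\<^esub> y" "lclass entails t \<sqsubseteq>\<^bsub>generated_lattice entails\<^esub> y"
    by (simp_all add: Upper_def lclass_closed)
  from y obtain u where u: "y = lclass entails u"
    by (auto simp: Upper_def carrier_generated_lattice)
  show "lclass entails (Join s t) \<sqsubseteq>\<^bsub>generated_lattice entails\<^esub> y"
    using le unfolding u lclass_le_iff by (rule lterm_le.join_least)
qed (auto simp: lclass_closed)

lemma greatest_lclass_Meet:
  "greatest (generated_lattice entails) (lclass entails (Meet s t))
     (Lower (generated_lattice entails) {lclass entails s, lclass entails t})"
proof (rule greatest_LowerI)
  fix x assume "x \<in> {lclass entails s, lclass entails t}"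
  then show "lclass entails (Meet s t) \<sqsubseteq>\<^bsub>generated_lattice entails\<^esub> x"
    using lterm_le.meet1 lterm_le.meet2 lclass_le_iff by (metis insert_iff singletonD)
next
  fix y assume y: "y \<in> Lower (generated_lattice entails) {lclass entails s, lclass entails t}"
  then have le: "y \<sqsubseteq>\<^bsub>generated_lattice entails\<^esub> lclass entails s" "y \<sqsubseteq>\<^bsub>generated_lattice entails\<^esub> lclass entails t"
    by (simp_all add: Lower_def lclass_closed)
  from y obtain u where u: "y = lclass entails u"
    by (auto simp: Lower_def carrier_generated_lattice)
  show "y \<sqsubseteq>\<^bsub>generated_lattice entails\<^esub> lclass entails (Meet s t)"
    using le unfolding u lclass_le_iff by (rule lterm_le.meet_greatest)
qed (auto simp: lclass_closed)

lemma lattice_generated_lattice: "lattice (generated_lattice entails)"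
proof -
  interpret partial_order "generated_lattice entails"
    by (rule partial_order_generated_lattice)
  show ?thesis
    by unfold_locales
      (auto simp: carrier_generated_lattice intro: least_lclass_Join greatest_lclass_Meet)
qed

lemma lclass_Join:
  "lclass entails (Join s t) = lclass entails s \<squnion>\<^bsub>generated_lattice entails\<^esub> lclass entails t"
proof -
  interpret lattice "generated_lattice entails" by (rule lattice_generated_lattice)
  show ?thesis
    using weak_least_unique[OF least_lclass_Join sup_of_two_least[OF lclass_closed lclass_closed]]
    by (simp add: eq_generated_lattice join_def)
qed

lemma lclass_Meet:
  "lclass entails (Meet s t) = lclass entails s \<sqinter>\<^bsub>generated_lattice entails\<^esub> lclass entails t"
proof -
  interpret lattice "generated_lattice entails" by (rule lattice_generated_lattice)
  show ?thesis
    using weak_greatest_unique[OF greatest_lclass_Meet inf_of_two_greatest[OF lclass_closed lclass_closed]]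
    by (simp add: eq_generated_lattice meet_def)
qed

theorem distributive_lattice_generated_lattice: "distributive_lattice (generated_lattice entails)"
proof -
  interpret lattice "generated_lattice entails" by (rule lattice_generated_lattice)
  have "lterm_le entails (Join (Meet s t) (Meet s u)) (Meet s (Join t u))" for s t u
    by (rule lterm_le.join_least; rule lterm_le.meet_greatest)
      (blast intro: lterm_le.meet1 lterm_le.meet2
        lterm_le.le_trans[OF lterm_le.meet2 lterm_le.join1]
        lterm_le.le_trans[OF lterm_le.meet2 lterm_le.join2])+
  then have "lclass entails (Meet s (Join t u)) = lclass entails (Join (Meet s t) (Meet s u))" for s t u
    unfolding lclass_eq_iff by (simp add: lterm_le.distrib)
  then show ?thesis
    by unfold_locales
      (auto simp only: carrier_generated_lattice lclass_Join[symmetric] lclass_Meet[symmetric])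
qed


subsection \<open>Universal property\<close>

primrec eval_lterm :: "('b, 'c) gorder_scheme \<Rightarrow> ('a \<Rightarrow> 'b) \<Rightarrow> 'a lterm \<Rightarrow> 'b" where
  "eval_lterm L f (Gen a) = f a"
| "eval_lterm L f (Meet s t) = eval_lterm L f s \<sqinter>\<^bsub>L\<^esub> eval_lterm L f t"
| "eval_lterm L f (Join s t) = eval_lterm L f s \<squnion>\<^bsub>L\<^esub> eval_lterm L f t"

lemma eval_lterm_closed:
  assumes "lattice L" "range f \<subseteq> carrier L"
  shows "eval_lterm L f s \<in> carrier L"
proof -
  interpret lattice L by fact
  show ?thesis using assms(2) by (induction s) auto
qed

lemma eval_gens_meet:
  assumes "lattice L" "range f \<subseteq> carrier L"
  shows "eval_lterm L f (gens_meet a as) = \<Sqinter>\<^bsub>L\<^esub> (f ` set (a # as))"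
proof -
  interpret lattice L by fact
  have cl: "eval_lterm L f s \<in> carrier L" for s using assms by (rule eval_lterm_closed)
  have f: "f b \<in> carrier L" for b using assms(2) by auto
  have "greatest L (eval_lterm L f (gens_meet a as)) (Lower L (f ` set (a # as)))"
  proof (induction as)
    case Nil
    show ?case using inf_of_singletonI[OF f] by (simp add: gens_meet_def)
  next
    case (Cons b as)
    let ?e = "eval_lterm L f (gens_meet a as)"
    have e: "eval_lterm L f (gens_meet a (b # as)) = f b \<sqinter>\<^bsub>L\<^esub> ?e" by (simp add: gens_meet_def)
    show ?case unfolding e
    proof (rule greatest_LowerI)
      fix x assume "x \<in> f ` set (a # b # as)"
      then consider "x = f b" | "x \<in> f ` set (a # as)" by auto
      then show "f b \<sqinter>\<^bsub>L\<^esub> ?e \<sqsubseteq>\<^bsub>L\<^esub> x"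
      proof cases
        case 1 then show ?thesis by (simp add: meet_left f cl)
      next
        case 2
        then have "?e \<sqsubseteq>\<^bsub>L\<^esub> x" "x \<in> carrier L"
          using greatest_Lower_below[OF Cons.IH, of x] f by blast+
        then show ?thesis by (meson le_trans meet_right meet_closed f cl)
      qed
    next
      fix y assume y: "y \<in> Lower L (f ` set (a # b # as))"
      then have yc: "y \<in> carrier L" by (meson Lower_closed subsetD)
      have "y \<in> Lower L (f ` set (a # as))" using y by (auto simp: Lower_def)
      then have "y \<sqsubseteq>\<^bsub>L\<^esub> ?e" by (rule greatest_le[OF Cons.IH])
      moreover have "y \<sqsubseteq>\<^bsub>L\<^esub> f b" using y f by (auto simp: Lower_def)
      ultimately show "y \<sqsubseteq>\<^bsub>L\<^esub> f b \<sqinter>\<^bsub>L\<^esub> ?e" by (simp add: meet_le f cl yc)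
    qed (auto simp: f cl)
  qed
  moreover have "greatest L (\<Sqinter>\<^bsub>L\<^esub> (f ` set (a # as))) (Lower L (f ` set (a # as)))"
    by (rule finite_inf_greatest) (auto simp: f)
  ultimately show ?thesis using weak_greatest_unique by (simp add: eq_is_equal)
qed

lemma eval_gens_join:
  assumes "lattice L" "range f \<subseteq> carrier L"
  shows "eval_lterm L f (gens_join a as) = \<Squnion>\<^bsub>L\<^esub> (f ` set (a # as))"
proof -
  have dual: "eval_lterm L f (gens_join a as) = eval_lterm (inv_gorder L) f (gens_meet a as)"
    by (induction as) (simp_all add: gens_join_def gens_meet_def)
  have "lattice (inv_gorder L)" using assms(1) by (rule lattice.dual_lattice)
  from eval_gens_meet[OF this, of f a as] assms(2) show ?thesis by (simp add: dual)
qed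

lemma eval_lterm_iota: "eval_lterm (generated_lattice entails) (iota entails) s = lclass entails s"
  by (induction s) (simp_all add: iota_def lclass_Meet lclass_Join)

theorem generated_lattice_relation:
  assumes "A \<in> Pfe" "B \<in> Pfe" "entails A B"
  shows "\<Sqinter>\<^bsub>generated_lattice entails\<^esub> (iota entails ` A)
    \<sqsubseteq>\<^bsub>generated_lattice entails\<^esub> \<Squnion>\<^bsub>generated_lattice entails\<^esub> (iota entails ` B)"
proof -
  have list: "\<exists>a as. C = set (a # as)" if "C \<in> Pfe" for C :: "'a set"
  proof -
    from that obtain xs where "set xs = C" "xs \<noteq> []"
      unfolding Pfe_def using finite_list[of C] by auto
    then show ?thesis by (metis neq_Nil_conv)
  qed
  obtain a as b bs where AB: "A = set (a # as)" "B = set (b # bs)"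
    using list[OF assms(1)] list[OF assms(2)] by blast
  have "lterm_le entails (gens_meet a as) (gens_join b bs)"
    using assms(3) unfolding AB by (rule lterm_le.relation)
  moreover have "range (iota entails) \<subseteq> carrier (generated_lattice entails)"
    using iota_closed by auto
  ultimately show ?thesis
    unfolding AB
    by (simp only: eval_gens_meet[OF lattice_generated_lattice, symmetric]
        eval_gens_join[OF lattice_generated_lattice, symmetric] eval_lterm_iota lclass_le_iff)
qed

theorem generated_lattice_universal:
  assumes L: "distributive_lattice L" and f: "range f \<subseteq> carrier L"
    and rel: "\<And>A B. entails A B \<Longrightarrow> \<Sqinter>\<^bsub>L\<^esub> (f ` A) \<sqsubseteq>\<^bsub>L\<^esub> \<Squnion>\<^bsub>L\<^esub> (f ` B)"
  defines "H \<equiv> generated_lattice entails"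
  shows "\<exists>!h. h \<in> carrier H \<rightarrow>\<^sub>E carrier L
    \<and> (\<forall>x\<in>carrier H. \<forall>y\<in>carrier H. h (x \<sqinter>\<^bsub>H\<^esub> y) = h x \<sqinter>\<^bsub>L\<^esub> h y \<and> h (x \<squnion>\<^bsub>H\<^esub> y) = h x \<squnion>\<^bsub>L\<^esub> h y)
    \<and> (\<forall>a. h (iota entails a) = f a)"
proof -
  interpret distributive_lattice L by (rule L)
  have lat: "lattice L" by (rule lattice_axioms)
  note cl = eval_lterm_closed[OF lat f] and L_trans = le_trans
  have mono: "eval_lterm L f s \<sqsubseteq>\<^bsub>L\<^esub> eval_lterm L f t" if "lterm_le entails s t" for s t
    using that
  proof induction
    case (le_trans s t u)
    show ?case by (rule L_trans[OF le_trans.IH cl cl cl])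
  next
    case (relation a as b bs)
    then show ?case by (simp only: eval_gens_meet[OF lat f] eval_gens_join[OF lat f] rel)
  qed (simp_all add: cl meet_left meet_right meet_le join_left join_right join_le meet_join_distrib)
  have eq: "eval_lterm L f s = eval_lterm L f t" if "lclass entails s = lclass entails t" for s t
    using that unfolding lclass_eq_iff by (intro le_antisym mono cl) simp_all
  define h where "h = (\<lambda>X\<in>carrier H. eval_lterm L f (SOME s. lclass entails s = X))"
  have h: "h (lclass entails s) = eval_lterm L f s" for s
  proof -
    have "lclass entails (SOME t. lclass entails t = lclass entails s) = lclass entails s"
      by (rule someI) (rule HOL.refl)
    from eq[OF this] show ?thesis by (simp add: h_def H_def lclass_closed)
  qed
  have C: "carrier H = range (lclass entails)" by (simp add: H_def carrier_generated_lattice)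
  show ?thesis
  proof (rule ex1I[of _ h], intro conjI)
    show "h \<in> carrier H \<rightarrow>\<^sub>E carrier L"
    proof (rule PiE_I)
      fix x assume "x \<in> carrier H"
      then show "h x \<in> carrier L" by (auto simp: C h cl)
    qed (simp add: h_def)
    show "\<forall>x\<in>carrier H. \<forall>y\<in>carrier H.
        h (x \<sqinter>\<^bsub>H\<^esub> y) = h x \<sqinter>\<^bsub>L\<^esub> h y \<and> h (x \<squnion>\<^bsub>H\<^esub> y) = h x \<squnion>\<^bsub>L\<^esub> h y"
      by (auto simp: C h) (simp_all add: H_def lclass_Meet[symmetric] lclass_Join[symmetric] h)
    show "\<forall>a. h (iota entails a) = f a" by (simp add: iota_def h)
  next
    fix g
    assume g: "g \<in> carrier H \<rightarrow>\<^sub>E carrier L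
      \<and> (\<forall>x\<in>carrier H. \<forall>y\<in>carrier H. g (x \<sqinter>\<^bsub>H\<^esub> y) = g x \<sqinter>\<^bsub>L\<^esub> g y \<and> g (x \<squnion>\<^bsub>H\<^esub> y) = g x \<squnion>\<^bsub>L\<^esub> g y)
      \<and> (\<forall>a. g (iota entails a) = f a)"
    have "g (lclass entails s) = eval_lterm L f s" for s
    proof (induction s)
      case (Gen a)
      then show ?case using g by (simp add: iota_def)
    qed (use g in \<open>simp_all add: H_def lclass_Meet lclass_Join lclass_closed\<close>)
    then have "g x = h x" if "x \<in> carrier H" for x using that by (auto simp: C h)
    moreover have "g x = h x" if "x \<notin> carrier H" for x
      using PiE_arb[OF conjunct1[OF g] that] that by (simp add: h_def)
    ultimately show "g = h" by blast
  qed
qed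


section \<open>Group laws on lattices\<close>

text \<open>The extensional function space makes operations on \<open>S\<close> equal as soon as they agree
  on \<open>S\<close>. Groups are commutative throughout.\<close>

definition group_law_on :: "'h set \<Rightarrow> ('h \<Rightarrow> 'h \<Rightarrow> 'h) \<Rightarrow> bool" where
  "group_law_on S p \<longleftrightarrow> p \<in> S \<rightarrow>\<^sub>E S \<rightarrow>\<^sub>E S \<and>
    (\<exists>e. comm_group \<lparr>carrier = S, monoid.mult = p, one = e\<rparr>)"

definition compatible_law :: "('h, 'b) gorder_scheme \<Rightarrow> ('h \<Rightarrow> 'h \<Rightarrow> 'h) \<Rightarrow> bool" where
  "compatible_law L p \<longleftrightarrow> (\<forall>x\<in>carrier L. \<forall>y\<in>carrier L. \<forall>z\<in>carrier L.
     p x (y \<sqinter>\<^bsub>L\<^esub> z) = p x y \<sqinter>\<^bsub>L\<^esub> p x z \<and> p x (y \<squnion>\<^bsub>L\<^esub> z) = p x y \<squnion>\<^bsub>L\<^esub> p x z)"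

definition lattice_ordered_group :: "('h, 'b) gorder_scheme \<Rightarrow> ('h \<Rightarrow> 'h \<Rightarrow> 'h) \<Rightarrow> bool" where
  "lattice_ordered_group L p \<longleftrightarrow> Lattice.lattice L \<and> group_law_on (carrier L) p \<and>
     (\<forall>x\<in>carrier L. \<forall>y\<in>carrier L. \<forall>z\<in>carrier L. x \<sqsubseteq>\<^bsub>L\<^esub> y \<longrightarrow> p x z \<sqsubseteq>\<^bsub>L\<^esub> p y z)"

definition group_law_of_ideals ::
    "('a::ordered_ab_group_add set \<Rightarrow> 'a set \<Rightarrow> bool) \<Rightarrow> ('a lterm set \<Rightarrow> 'a lterm set \<Rightarrow> 'a lterm set) \<Rightarrow> bool"
  where "group_law_of_ideals entails p \<longleftrightarrow>
    group_law_on (carrier (generated_lattice entails)) p \<and>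
    compatible_law (generated_lattice entails) p \<and>
    (\<forall>a b. iota entails (a + b) = p (iota entails a) (iota entails b))"

end

theory Submission
  imports Defs
begin

text \<open>A prime filter of the generated lattice is given by a set \<open>P\<close> of elements of \<open>G\<close> that meets
  \<open>B\<close> whenever \<open>A \<turnstile> B\<close> and \<open>A \<subseteq> P\<close>. Regularity says exactly that the translation-invariant preorder
  \<open>a \<preceq> b \<longleftrightarrow> (\<forall>x. x + a \<in> P \<longrightarrow> x + b \<in> P)\<close> is total. Since prime filters separate the elements
  of a distributive lattice, the generated lattice embeds into a product of linearly ordered
  quotients of \<open>G\<close>. The group operations are defined on lattice terms by distributivity and
  De Morgan's laws, and all the required identities hold since they hold in each factor.\<close>

section \<open>Prime filters\<close>

text \<open>This is evaluation in the two-element lattice, with the elements of \<open>P\<close>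
  sent to true.\<close>

primrec sat :: "'a set \<Rightarrow> 'a lterm \<Rightarrow> bool" where
  "sat P (Gen a) \<longleftrightarrow> a \<in> P"
| "sat P (Meet s t) \<longleftrightarrow> sat P s \<and> sat P t"
| "sat P (Join s t) \<longleftrightarrow> sat P s \<or> sat P t"

lemma sat_gens_meet: "sat P (gens_meet a as) \<longleftrightarrow> set (a # as) \<subseteq> P"
  unfolding gens_meet_def by (induction as) auto

lemma sat_gens_join: "sat P (gens_join a as) \<longleftrightarrow> set (a # as) \<inter> P \<noteq> {}"
  unfolding gens_join_def by (induction as) auto

lemma lterm_le_Meet_mono:
  assumes "lterm_le entails s s'" "lterm_le entails t t'"
  shows "lterm_le entails (Meet s t) (Meet s' t')"
  by (rule lterm_le.meet_greatest
      [OF lterm_le.le_trans[OF lterm_le.meet1 assms(1)] lterm_le.le_trans[OF lterm_le.meet2 assms(2)]])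

text \<open>The prime filter theorem, stated for terms instead of classes. Zorn's lemma gives a
  filter that is maximal among those containing \<open>s\<close> and omitting \<open>t\<close>, and
  distributivity makes it prime.\<close>

lemma lterm_le_prime_filter:
  assumes "\<not> lterm_le entails s t"
  obtains M where "s \<in> M" "t \<notin> M"
    "\<And>u v. u \<in> M \<Longrightarrow> lterm_le entails u v \<Longrightarrow> v \<in> M"
    "\<And>u v. u \<in> M \<Longrightarrow> v \<in> M \<Longrightarrow> Meet u v \<in> M"
    "\<And>u v. Join u v \<in> M \<Longrightarrow> u \<in> M \<or> v \<in> M"
proof -
  note tr = lterm_le.le_trans
  define \<F> where "\<F> = {F. s \<in> F \<and> t \<notin> F \<and> (\<forall>u v. u \<in> F \<longrightarrow> lterm_le entails u v \<longrightarrow> v \<in> F)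
    \<and> (\<forall>u v. u \<in> F \<longrightarrow> v \<in> F \<longrightarrow> Meet u v \<in> F)}"
  have "{u. lterm_le entails s u} \<in> \<F>"
    using assms by (auto simp: \<F>_def intro: lterm_le.le_refl lterm_le.meet_greatest tr)
  then have "\<F> \<noteq> {}" by blast
  moreover have "\<Union>C \<in> \<F>" if "C \<noteq> {}" "subset.chain \<F> C" for C
  proof -
    have C: "C \<subseteq> \<F>" and chain: "\<And>X Y. X \<in> C \<Longrightarrow> Y \<in> C \<Longrightarrow> X \<subseteq> Y \<or> Y \<subseteq> X"
      using that(2) by (auto simp: subset_chain_def)
    have "Meet u v \<in> \<Union>C" if uv: "u \<in> \<Union>C" "v \<in> \<Union>C" for u v
    proof -
      obtain X Y where XY: "X \<in> C" "Y \<in> C" "u \<in> X" "v \<in> Y" using uv by blast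
      then obtain Z where "Z \<in> C" "u \<in> Z" "v \<in> Z" using chain by blast
      then show ?thesis using C unfolding \<F>_def by blast
    qed
    then show ?thesis using C that(1) unfolding \<F>_def by blast
  qed
  ultimately obtain M where M: "M \<in> \<F>" and max: "\<And>X. X \<in> \<F> \<Longrightarrow> M \<subseteq> X \<Longrightarrow> X = M"
    using subset_Zorn_nonempty[of \<F>] by blast
  have up: "v \<in> M" if "u \<in> M" "lterm_le entails u v" for u v
    using M that unfolding \<F>_def by blast
  have meet: "Meet u v \<in> M" if "u \<in> M" "v \<in> M" for u v
    using M that unfolding \<F>_def by blast
  have sM: "s \<in> M" and tM: "t \<notin> M" using M unfolding \<F>_def by blast+
  have extend: "\<exists>m\<in>M. lterm_le entails (Meet m u) t" if "u \<notin> M" for u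
  proof (rule ccontr)
    assume neg: "\<not> (\<exists>m\<in>M. lterm_le entails (Meet m u) t)"
    \<comment> \<open>\<open>N\<close> is the filter generated by \<open>M\<close> and
      \<open>u\<close>. If it omitted \<open>t\<close>, maximality would force \<open>N = M\<close>
      and hence \<open>u \<in> M\<close>.\<close>
    define N where "N = {w. \<exists>m\<in>M. lterm_le entails (Meet m u) w}"
    have "Meet v w \<in> N" if "v \<in> N" "w \<in> N" for v w
    proof -
      obtain m where m: "m \<in> M" "lterm_le entails (Meet m u) v"
        using \<open>v \<in> N\<close> unfolding N_def by blast
      obtain n where n: "n \<in> M" "lterm_le entails (Meet n u) w"
        using \<open>w \<in> N\<close> unfolding N_def by blast
      have "lterm_le entails (Meet (Meet m n) u) (Meet m u)"
        "lterm_le entails (Meet (Meet m n) u) (Meet n u)"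
        by (blast intro: lterm_le_Meet_mono lterm_le.meet1 lterm_le.meet2 lterm_le.le_refl)+
      then have "lterm_le entails (Meet (Meet m n) u) (Meet v w)"
        using tr[OF _ m(2)] tr[OF _ n(2)] by (blast intro: lterm_le.meet_greatest)
      then show ?thesis unfolding N_def using meet[OF m(1) n(1)] by blast
    qed
    moreover have MN: "M \<subseteq> N" unfolding N_def by (blast intro: lterm_le.meet1)
    moreover have "w \<in> N" if "v \<in> N" "lterm_le entails v w" for v w
      using that unfolding N_def by (blast intro: tr)
    ultimately have "N \<in> \<F>" using sM neg unfolding \<F>_def N_def by blast
    then have "N = M" using MN by (rule max)
    moreover have "u \<in> N" unfolding N_def using sM by (blast intro: lterm_le.meet2)
    ultimately show False using that by blast
  qed
  have prime: "u \<in> M \<or> v \<in> M" if uv: "Join u v \<in> M" for u v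
  proof (rule ccontr)
    assume "\<not> (u \<in> M \<or> v \<in> M)"
    then obtain m n where mn: "m \<in> M" "lterm_le entails (Meet m u) t"
      "n \<in> M" "lterm_le entails (Meet n v) t"
      using extend by blast
    \<comment> \<open>A single element of \<open>M\<close> has to serve both \<open>u\<close> and
      \<open>v\<close>, so that \<open>distrib\<close> puts \<open>Meet ?k (Join u v)\<close> below
      \<open>t\<close>.\<close>
    let ?k = "Meet m n"
    have "lterm_le entails (Meet ?k u) (Meet m u)" "lterm_le entails (Meet ?k v) (Meet n v)"
      by (blast intro: lterm_le_Meet_mono lterm_le.meet1 lterm_le.meet2 lterm_le.le_refl)+
    then have "lterm_le entails (Join (Meet ?k u) (Meet ?k v)) t"
      using tr[OF _ mn(2)] tr[OF _ mn(4)] by (blast intro: lterm_le.join_least)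
    then have "lterm_le entails (Meet ?k (Join u v)) t"
      by (rule tr[OF lterm_le.distrib])
    then show False using up meet mn(1,3) uv tM by blast
  qed
  show thesis by (rule that[OF sM tM up meet prime])
qed

text \<open>A prime filter is determined by the generators it contains: being prime and closed under
  meets, it contains exactly the terms that are true under \<open>P\<close>. The rule
  \<open>relation\<close> then turns each entailment into a closure condition on
  \<open>P\<close>.\<close>

lemma (in unbounded_entailment) lterm_le_separation:
  assumes "\<not> lterm_le entails s t"
  obtains P where "sat P s" "\<not> sat P t" "\<And>A B. A \<turnstile> B \<Longrightarrow> A \<subseteq> P \<Longrightarrow> B \<inter> P \<noteq> {}"
proof -
  obtain M where M: "s \<in> M" "t \<notin> M"
    "\<And>u v. u \<in> M \<Longrightarrow> lterm_le entails u v \<Longrightarrow> v \<in> M"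
    "\<And>u v. u \<in> M \<Longrightarrow> v \<in> M \<Longrightarrow> Meet u v \<in> M"
    "\<And>u v. Join u v \<in> M \<Longrightarrow> u \<in> M \<or> v \<in> M"
    using lterm_le_prime_filter[OF assms] by blast
  define P where "P = {a. Gen a \<in> M}"
  have P: "sat P u \<longleftrightarrow> u \<in> M" for u
  proof (induction u)
    case (Meet u v)
    have "Meet u v \<in> M \<longleftrightarrow> u \<in> M \<and> v \<in> M"
      using M(3)[OF _ lterm_le.meet1[of entails u v]] M(3)[OF _ lterm_le.meet2[of entails u v]] M(4)[of u v]
      by blast
    then show ?case using Meet.IH by simp
  next
    case (Join u v)
    have "Join u v \<in> M \<longleftrightarrow> u \<in> M \<or> v \<in> M"
      using M(3)[OF _ lterm_le.join1[of entails u v]] M(3)[OF _ lterm_le.join2[of entails v u]] M(5)[of u v]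
      by blast
    then show ?case using Join.IH by simp
  qed (simp add: P_def)
  have list: "\<exists>a as. C = set (a # as)" if C: "C \<in> Pfe" for C :: "'a set"
  proof -
    obtain xs where "set xs = C" "xs \<noteq> []"
      using C finite_list[of C] by (auto simp: Pfe_def)
    then show ?thesis by (cases xs) auto
  qed
  have "B \<inter> P \<noteq> {}" if AB: "A \<turnstile> B" "A \<subseteq> P" for A B
  proof -
    have "A \<in> Pfe" "B \<in> Pfe" using dom[OF AB(1)] by blast+
    then obtain a as b bs where eq: "A = set (a # as)" "B = set (b # bs)"
      using list[of A] list[of B] by auto
    have "gens_meet a as \<in> M" using AB(2) unfolding eq by (simp only: sat_gens_meet P[symmetric])
    moreover have "lterm_le entails (gens_meet a as) (gens_join b bs)"
      using AB(1) unfolding eq by (rule lterm_le.relation)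
    ultimately have "sat P (gens_join b bs)" unfolding P by (rule M(3))
    then show ?thesis unfolding sat_gens_join eq .
  qed
  then show thesis using that[of P] M(1,2) P by simp
qed


section \<open>Linear preorders\<close>

text \<open>Such a preorder is a linearly ordered quotient group in disguise. Omitting antisymmetry
  permits computing with elements of the group itself rather than with cosets.\<close>

locale linear_group_preorder =
  fixes r :: "'a::ab_group_add \<Rightarrow> 'a \<Rightarrow> bool"  (infix \<open>\<preceq>\<close> 50)
  assumes total: "a \<preceq> b \<or> b \<preceq> a"
    and trans: "a \<preceq> b \<Longrightarrow> b \<preceq> c \<Longrightarrow> a \<preceq> c"
    and translate: "a \<preceq> b \<Longrightarrow> c + a \<preceq> c + b"
begin

lemma reflexive: "a \<preceq> a"
  using total by blast

lemma le_add_iff: "c \<preceq> a + b \<longleftrightarrow> c - b \<preceq> a"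
  using translate[of c "a + b" "- b"] translate[of "c - b" a b] by (auto simp: algebra_simps)

lemma le_add_iff_left: "c \<preceq> a + b \<longleftrightarrow> c - a \<preceq> b"
  using le_add_iff[of c b a] by (simp only: add.commute)

lemma le_uminus_iff: "c \<preceq> - a \<longleftrightarrow> a \<preceq> - c"
  using translate[of c "- a" "a - c"] translate[of a "- c" "c - a"] by auto

text \<open>Meet and join become minimum and maximum. The result matters only up to equivalence
  under \<open>\<preceq>\<close>, since ties are broken arbitrarily. Later arguments therefore
  compare values with an element \<open>c\<close> instead of equating them.\<close>

primrec val :: "'a lterm \<Rightarrow> 'a" where
  "val (Gen a) = a"
| "val (Meet s t) = (if val s \<preceq> val t then val s else val t)"
| "val (Join s t) = (if val s \<preceq> val t then val t else val s)"

lemma le_val_Meet: "c \<preceq> val (Meet s t) \<longleftrightarrow> c \<preceq> val s \<and> c \<preceq> val t"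
  by simp (metis total trans)

lemma le_val_Join: "c \<preceq> val (Join s t) \<longleftrightarrow> c \<preceq> val s \<or> c \<preceq> val t"
  by simp (metis total trans)

lemma val_Meet_le: "val (Meet s t) \<preceq> c \<longleftrightarrow> val s \<preceq> c \<or> val t \<preceq> c"
  by simp (metis total trans)

lemma val_Join_le: "val (Join s t) \<preceq> c \<longleftrightarrow> val s \<preceq> c \<and> val t \<preceq> c"
  by simp (metis total trans)

lemmas val_rules = le_val_Meet le_val_Join val_Meet_le val_Join_le

text \<open>Without the case distinctions of \<open>val\<close>, the simplifier can apply the
  comparison rules just collected.\<close>

declare val.simps(2,3) [simp del]

text \<open>The value of a meet or join is the value of one of its two arguments, and the assumption
  that \<open>P\<close> is closed upwards settles the other argument.\<close>

lemma sat_iff_val: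
  assumes "\<And>a b. a \<preceq> b \<Longrightarrow> a \<in> P \<Longrightarrow> b \<in> P"
  shows "sat P s \<longleftrightarrow> val s \<in> P"
proof (induction s)
  case (Meet s t)
  then show ?case using assms[of "val s" "val t"] assms[of "val t" "val s"] total[of "val s" "val t"]
    by (auto simp: val.simps)
next
  case (Join s t)
  then show ?case using assms[of "val s" "val t"] assms[of "val t" "val s"] total[of "val s" "val t"]
    by (auto simp: val.simps)
qed simp

lemma val_gens_meet_le: "val (gens_meet a as) \<preceq> c \<longleftrightarrow> (\<exists>b\<in>set (a # as). b \<preceq> c)"
  unfolding gens_meet_def by (induction as) (auto simp: val_rules)

lemma le_val_gens_join: "c \<preceq> val (gens_join a as) \<longleftrightarrow> (\<exists>b\<in>set (a # as). c \<preceq> b)"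
  unfolding gens_join_def by (induction as) (auto simp: val_rules)

text \<open>Soundness: a chain is a distributive lattice, and in a chain the minimum of
  \<open>A\<close> lies below the maximum of \<open>B\<close> exactly when some \<open>a\<close>
  lies below some \<open>b\<close>.\<close>

lemma lterm_le_val:
  assumes "\<And>A B. entails A B \<Longrightarrow> \<exists>a\<in>A. \<exists>b\<in>B. a \<preceq> b" and "lterm_le entails s t"
  shows "val s \<preceq> val t"
  using assms(2)
proof induction
  case (relation a as b bs)
  then show ?case using assms(1) unfolding val_gens_meet_le le_val_gens_join by blast
next
  case (distrib s t u)
  then show ?case using total[of "val t" "val u"] by (auto simp: val_rules reflexive)
next
  case (le_trans s t u)
  show ?case using le_trans.IH by (rule trans)
qed (simp_all add: val_rules reflexive)

end


section \<open>Group operations on lattice terms\<close>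

text \<open>The recursion expands the first argument and then translates the second by each
  generator. This is asymmetric on terms; commutativity is recovered for classes.\<close>

primrec lterm_plus :: "'a::plus lterm \<Rightarrow> 'a lterm \<Rightarrow> 'a lterm" where
  "lterm_plus (Gen a) u = map_lterm ((+) a) u"
| "lterm_plus (Meet s t) u = Meet (lterm_plus s u) (lterm_plus t u)"
| "lterm_plus (Join s t) u = Join (lterm_plus s u) (lterm_plus t u)"

primrec lterm_uminus :: "'a::uminus lterm \<Rightarrow> 'a lterm" where
  "lterm_uminus (Gen a) = Gen (- a)"
| "lterm_uminus (Meet s t) = Join (lterm_uminus s) (lterm_uminus t)"
| "lterm_uminus (Join s t) = Meet (lterm_uminus s) (lterm_uminus t)"

context linear_group_preorder
begin

lemma le_val_map: "c \<preceq> val (map_lterm ((+) a) s) \<longleftrightarrow> c - a \<preceq> val s"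
  by (induction s) (simp_all add: val_rules le_add_iff[of c _ a] add.commute[of a])

lemma le_val_plus: "c \<preceq> val (lterm_plus s t) \<longleftrightarrow> c \<preceq> val s + val t"
proof (induction s)
  case (Gen a)
  then show ?case using le_add_iff[of c "val t" a] by (simp add: le_val_map add.commute)
qed (simp_all add: val_rules le_add_iff)

lemma le_val_uminus: "c \<preceq> val (lterm_uminus s) \<longleftrightarrow> c \<preceq> - val s"
proof -
  \<comment> \<open>With \<open>val s\<close> on the left, the rules for upper bounds of meets and
    joins mirror the exchange of \<open>Meet\<close> and \<open>Join\<close> by
    \<open>lterm_uminus\<close>, so the induction goes through.\<close>
  have "c \<preceq> val (lterm_uminus s) \<longleftrightarrow> val s \<preceq> - c"
  proof (induction s)
    case (Gen a)
    show ?case using le_uminus_iff[of c a] by simp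
  qed (simp_all add: val_rules)
  then show ?thesis unfolding le_uminus_iff[of c] .
qed

text \<open>The value of a sum of terms is only equivalent to the sum of the values, so it cannot be
  rewritten by an equation inside a larger sum. This rule and the next three carry out such
  rewriting under one summand \<open>a\<close>.\<close>

lemma le_add_val_plus: "c \<preceq> a + val (lterm_plus s t) \<longleftrightarrow> c \<preceq> a + (val s + val t)"
  by (simp only: le_add_iff_left le_val_plus)

lemma le_add_val_uminus: "c \<preceq> a + val (lterm_uminus s) \<longleftrightarrow> c \<preceq> a + - val s"
  by (simp only: le_add_iff_left le_val_uminus)

lemma le_add_val_Meet: "c \<preceq> a + val (Meet s t) \<longleftrightarrow> c \<preceq> a + val s \<and> c \<preceq> a + val t"
  by (simp only: le_add_iff_left le_val_Meet)

lemma le_add_val_Join: "c \<preceq> a + val (Join s t) \<longleftrightarrow> c \<preceq> a + val s \<or> c \<preceq> a + val t"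
  by (simp only: le_add_iff_left le_val_Join)

lemmas val_group_rules = le_val_plus le_val_uminus le_add_val_plus le_add_val_uminus
  le_add_val_Meet le_add_val_Join

end

section \<open>Linear preorders that respect a regular entailment relation\<close>

context regular_entailment
begin

text \<open>The second conjunct says that the minimum of \<open>A\<close> is below the maximum of
  \<open>B\<close>, which is the defining relation of the generated lattice read in the linear
  quotient of \<open>r\<close>.\<close>

definition respecting :: "('a \<Rightarrow> 'a \<Rightarrow> bool) \<Rightarrow> bool" where
  "respecting r \<longleftrightarrow> linear_group_preorder r \<and> (\<forall>A B. A \<turnstile> B \<longrightarrow> (\<exists>a\<in>A. \<exists>b\<in>B. r a b))"

abbreviation value_in :: "('a \<Rightarrow> 'a \<Rightarrow> bool) \<Rightarrow> 'a lterm \<Rightarrow> 'a" where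
  "value_in \<equiv> linear_group_preorder.val"

text \<open>If totality fails for \<open>a\<close> and \<open>b\<close>, the witnesses
  \<open>x\<close> and \<open>y\<close> put \<open>x + a\<close> and \<open>y + b\<close> in
  \<open>P\<close> but \<open>y + a\<close> and \<open>x + b\<close> outside, against
  \<open>regularity\<close>. If \<open>A \<turnstile> B\<close>, totality gives a least
  \<open>m\<close> in \<open>A\<close> and a greatest \<open>n\<close> in \<open>B\<close>. A shift
  that moves \<open>m\<close> into \<open>P\<close> and \<open>n\<close> out of it would move all of
  \<open>A\<close> in and all of \<open>B\<close> out, against \<open>translation\<close>.\<close>

lemma respecting_order_of_prime:
  assumes P: "\<And>A B. A \<turnstile> B \<Longrightarrow> A \<subseteq> P \<Longrightarrow> B \<inter> P \<noteq> {}"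
  shows "respecting (\<lambda>a b. \<forall>x. x + a \<in> P \<longrightarrow> x + b \<in> P)" (is "respecting ?r")
proof -
  have lin: "linear_group_preorder ?r"
  proof
    show "?r a b \<or> ?r b a" for a b
    proof (rule ccontr)
      assume "\<not> (?r a b \<or> ?r b a)"
      then obtain x y where "x + a \<in> P" "x + b \<notin> P" "y + b \<in> P" "y + a \<notin> P" by blast
      then show False using P[OF regularity[of x a y b]] by auto
    qed
    show "?r (c + a) (c + b)" if "?r a b" for a b c
      using that by (metis add.assoc)
  qed blast
  interpret linear_group_preorder ?r by (rule lin)
  have "\<exists>a\<in>A. \<exists>b\<in>B. ?r a b" if AB: "A \<turnstile> B" for A B
  proof (rule ccontr)
    assume neg: "\<not> (\<exists>a\<in>A. \<exists>b\<in>B. ?r a b)"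
    have fin: "finite A" "A \<noteq> {}" using dom[OF AB] by (auto simp: Pfe_def)
    have "\<exists>m\<in>A. \<forall>a\<in>A. ?r m a"
      using fin
    proof (induction rule: finite_ne_induct)
      case (insert a A)
      then obtain m where m: "m \<in> A" "\<forall>a\<in>A. ?r m a" by blast
      show ?case
      proof (cases "?r a m")
        case True
        then show ?thesis using m by (intro bexI[of _ a]) auto
      next
        case False
        then have "?r m a" using total by blast
        then show ?thesis using m by (intro bexI[of _ m]) auto
      qed
    qed auto
    then obtain m where m: "m \<in> A" "\<And>a. a \<in> A \<Longrightarrow> ?r m a" by blast
    have "finite B" "B \<noteq> {}" using dom[OF AB] by (auto simp: Pfe_def)
    then have "\<exists>n\<in>B. \<forall>b\<in>B. ?r b n"
    proof (induction rule: finite_ne_induct)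
      case (insert b B)
      then obtain n where n: "n \<in> B" "\<forall>b\<in>B. ?r b n" by blast
      show ?case
      proof (cases "?r n b")
        case True
        then show ?thesis using n by (intro bexI[of _ b]) auto
      next
        case False
        then have "?r b n" using total by blast
        then show ?thesis using n by (intro bexI[of _ n]) auto
      qed
    qed auto
    then obtain n where n: "n \<in> B" "\<And>b. b \<in> B \<Longrightarrow> ?r b n" by blast
    obtain x where x: "x + m \<in> P" "x + n \<notin> P" using neg m(1) n(1) by blast
    have "(+) x ` A \<subseteq> P" using m(2) x(1) by blast
    then obtain b where "b \<in> B" "x + b \<in> P" using P[OF translation[OF AB, of x]] by blast
    then show False using n(2) x(2) by blast
  qed
  then show ?thesis unfolding respecting_def using lin by blast
qed

text \<open>In this form the right-hand side can be simplified by the rules for \<^term>\<open>r c (value_in r s)\<close>.\<close>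

lemma lterm_le_iff_val:
  "lterm_le entails s t \<longleftrightarrow> (\<forall>r. respecting r \<longrightarrow> (\<forall>c. r c (value_in r s) \<longrightarrow> r c (value_in r t)))"
proof
  assume st: "lterm_le entails s t"
  show "\<forall>r. respecting r \<longrightarrow> (\<forall>c. r c (value_in r s) \<longrightarrow> r c (value_in r t))"
  proof (intro allI impI)
    fix r :: "'a \<Rightarrow> 'a \<Rightarrow> bool" and c assume r: "respecting r" and c: "r c (value_in r s)"
    interpret linear_group_preorder r using r by (simp add: respecting_def)
    have "r (val s) (val t)" using lterm_le_val[OF _ st] r unfolding respecting_def by blast
    then show "r c (val t)" by (rule trans[OF c])
  qed
next
  assume *: "\<forall>r. respecting r \<longrightarrow> (\<forall>c. r c (value_in r s) \<longrightarrow> r c (value_in r t))"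
  show "lterm_le entails s t"
  proof (rule ccontr)
    assume "\<not> lterm_le entails s t"
    then obtain P where P: "sat P s" "\<not> sat P t" "\<And>A B. A \<turnstile> B \<Longrightarrow> A \<subseteq> P \<Longrightarrow> B \<inter> P \<noteq> {}"
      using lterm_le_separation by blast
    let ?r = "\<lambda>a b. \<forall>x. x + a \<in> P \<longrightarrow> x + b \<in> P"
    have r: "respecting ?r" using P(3) by (rule respecting_order_of_prime)
    interpret linear_group_preorder ?r using r by (simp add: respecting_def)
    \<comment> \<open>The instance \<open>x = 0\<close> of the preorder shows that \<open>P\<close>
      is closed upwards, so membership of the value in \<open>P\<close> decides
      \<open>sat\<close>.\<close>
    have up: "b \<in> P" if "?r a b" "a \<in> P" for a b
      using that(1)[rule_format, of 0] that(2) by simp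
    have "?r (val s) (val t)" using *[rule_format, OF r] reflexive by blast
    moreover have "sat P u \<longleftrightarrow> val u \<in> P" for u by (rule sat_iff_val) (rule up)
    ultimately show False using P(1,2) up by blast
  qed
qed

section \<open>Identities of the group operations on classes of terms\<close>

lemma lclass_eq_iff_val:
  "lclass entails s = lclass entails t \<longleftrightarrow>
    (\<forall>r. respecting r \<longrightarrow> (\<forall>c. r c (value_in r s) \<longleftrightarrow> r c (value_in r t)))"
  unfolding lclass_eq_iff lterm_le_iff_val by blast

text \<open>Used for identities that hold in every linear quotient, whether or not it respects
  \<open>\<turnstile>\<close>.\<close>

lemma lclass_eqI:
  assumes "\<And>r c. linear_group_preorder r \<Longrightarrow> r c (value_in r s) \<longleftrightarrow> r c (value_in r t)"
  shows "lclass entails s = lclass entails t"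
  using assms unfolding lclass_eq_iff_val respecting_def by blast

text \<open>This makes addition well defined on classes and monotone. One summand is replaced at a
  time, while \<open>le_add_iff\<close> moves the other to the left-hand side.\<close>

lemma lterm_plus_mono:
  assumes "lterm_le entails s s'" "lterm_le entails t t'"
  shows "lterm_le entails (lterm_plus s t) (lterm_plus s' t')"
  unfolding lterm_le_iff_val
proof (intro allI impI)
  fix r :: "'a \<Rightarrow> 'a \<Rightarrow> bool" and c assume r: "respecting r" and c: "r c (value_in r (lterm_plus s t))"
  interpret linear_group_preorder r using r by (simp add: respecting_def)
  have s: "r x (val s')" if "r x (val s)" for x
    using assms(1) r that unfolding lterm_le_iff_val by blast
  have t: "r x (val t')" if "r x (val t)" for x
    using assms(2) r that unfolding lterm_le_iff_val by blast
  have "r c (val s + val t)" using c by (simp add: le_val_plus)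
  then have "r c (val t + val s')" using s by (metis le_add_iff add.commute)
  then have "r c (val s' + val t')" using t by (metis le_add_iff add.commute)
  then show "r c (val (lterm_plus s' t'))" by (simp add: le_val_plus)
qed

lemma lclass_plus_commute:
  "lclass entails (lterm_plus s t) = lclass entails (lterm_plus t s)"
proof (rule lclass_eqI)
  fix r :: "'a \<Rightarrow> 'a \<Rightarrow> bool" and c assume "linear_group_preorder r"
  then interpret linear_group_preorder r .
  show "r c (val (lterm_plus s t)) \<longleftrightarrow> r c (val (lterm_plus t s))"
    by (simp add: val_group_rules add.commute)
qed

lemma lclass_plus_assoc:
  "lclass entails (lterm_plus (lterm_plus s t) u) = lclass entails (lterm_plus s (lterm_plus t u))"
proof (rule lclass_eqI)
  fix r :: "'a \<Rightarrow> 'a \<Rightarrow> bool" and c assume "linear_group_preorder r"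
  then interpret linear_group_preorder r .
  show "r c (val (lterm_plus (lterm_plus s t) u)) \<longleftrightarrow> r c (val (lterm_plus s (lterm_plus t u)))"
    \<comment> \<open>The commutation brings the inner sum \<open>lterm_plus s t\<close> into the
      right summand, the position that \<open>le_add_val_plus\<close> rewrites.\<close>
    by (simp add: val_group_rules add.commute[of "val (lterm_plus s t)"]) (simp add: ac_simps)
qed

lemma lclass_plus_zero: "lclass entails (lterm_plus (Gen 0) s) = lclass entails s"
proof (rule lclass_eqI)
  fix r :: "'a \<Rightarrow> 'a \<Rightarrow> bool" and c assume "linear_group_preorder r"
  then interpret linear_group_preorder r .
  show "r c (val (lterm_plus (Gen 0) s)) \<longleftrightarrow> r c (val s)"
    by (simp only: val_group_rules) simp
qed

lemma lclass_plus_uminus: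
  "lclass entails (lterm_plus s (lterm_uminus s)) = lclass entails (Gen 0)"
proof (rule lclass_eqI)
  fix r :: "'a \<Rightarrow> 'a \<Rightarrow> bool" and c assume "linear_group_preorder r"
  then interpret linear_group_preorder r .
  show "r c (val (lterm_plus s (lterm_uminus s))) \<longleftrightarrow> r c (val (Gen 0))"
    by (simp add: val_group_rules del: add_uminus_conv_diff)
qed

lemma lclass_plus_Meet:
  "lclass entails (lterm_plus s (Meet t u))
    = lclass entails (Meet (lterm_plus s t) (lterm_plus s u))"
proof (rule lclass_eqI)
  fix r :: "'a \<Rightarrow> 'a \<Rightarrow> bool" and c assume "linear_group_preorder r"
  then interpret linear_group_preorder r .
  show "r c (val (lterm_plus s (Meet t u))) \<longleftrightarrow> r c (val (Meet (lterm_plus s t) (lterm_plus s u)))"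
    by (simp add: val_group_rules val_rules)
qed

lemma lclass_plus_Join:
  "lclass entails (lterm_plus s (Join t u))
    = lclass entails (Join (lterm_plus s t) (lterm_plus s u))"
proof (rule lclass_eqI)
  fix r :: "'a \<Rightarrow> 'a \<Rightarrow> bool" and c assume "linear_group_preorder r"
  then interpret linear_group_preorder r .
  show "r c (val (lterm_plus s (Join t u))) \<longleftrightarrow> r c (val (Join (lterm_plus s t) (lterm_plus s u)))"
    by (simp add: val_group_rules val_rules)
qed


section \<open>The group law\<close>

abbreviation "H \<equiv> generated_lattice entails"

text \<open>Both arguments are restricted to the carrier because \<open>group_law_on\<close> asks
  for an extensional operation; only then can uniqueness be an equality of functions.\<close>

definition ideal_plus :: "'a lterm set \<Rightarrow> 'a lterm set \<Rightarrow> 'a lterm set" where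
  "ideal_plus = (\<lambda>X\<in>carrier H. \<lambda>Y\<in>carrier H.
    lclass entails (lterm_plus (SOME s. s \<in> X) (SOME t. t \<in> Y)))"

lemma ideal_plus_lclass:
  "ideal_plus (lclass entails s) (lclass entails t) = lclass entails (lterm_plus s t)"
proof -
  have "lclass entails (SOME u. u \<in> lclass entails s) = lclass entails s" for s
  proof -
    have "(SOME u. u \<in> lclass entails s) \<in> lclass entails s" using lclass_self by (rule someI)
    then show ?thesis unfolding lclass_eq_iff by (auto simp: lclass_def lterm_eq_def)
  qed
  then have "lclass entails (lterm_plus (SOME u. u \<in> lclass entails s) (SOME u. u \<in> lclass entails t))
      = lclass entails (lterm_plus s t)"
    unfolding lclass_eq_iff by (blast intro: lterm_plus_mono)
  then show ?thesis by (simp add: ideal_plus_def lclass_closed)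
qed

lemma comm_group_ideal_plus:
  "comm_group \<lparr>carrier = carrier H, monoid.mult = ideal_plus, one = iota entails 0\<rparr>"
proof (rule comm_groupI, goal_cases)
  \<comment> \<open>Case 6 is the existence of an inverse and case 4 is commutativity.\<close>
  case (6 x)
  then obtain s where s: "x = lclass entails s" by (auto simp: carrier_generated_lattice)
  have "ideal_plus (lclass entails (lterm_uminus s)) x = iota entails 0"
    by (simp only: s ideal_plus_lclass iota_def lclass_plus_commute[of "lterm_uminus s"] lclass_plus_uminus)
  then show ?case using lclass_closed[of entails "lterm_uminus s"] by auto
next
  case (4 x y)
  then obtain s t where "x = lclass entails s" "y = lclass entails t"
    by (auto simp: carrier_generated_lattice)
  then show ?case using lclass_plus_commute[of s t] by (simp add: ideal_plus_lclass)
qed (auto simp: carrier_generated_lattice ideal_plus_lclass iota_def lclass_plus_assoc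
      lclass_plus_zero simp del: lterm_plus.simps)

lemma group_law_of_ideals_ideal_plus: "group_law_of_ideals entails ideal_plus"
  unfolding group_law_of_ideals_def
proof (intro conjI allI)
  have "ideal_plus \<in> carrier H \<rightarrow>\<^sub>E carrier H \<rightarrow>\<^sub>E carrier H"
    by (auto simp: ideal_plus_def intro: lclass_closed)
  then show "group_law_on (carrier H) ideal_plus"
    unfolding group_law_on_def using comm_group_ideal_plus by blast
  show "compatible_law H ideal_plus"
    unfolding compatible_law_def
    by (auto simp: carrier_generated_lattice lclass_Meet[symmetric] lclass_Join[symmetric]
        ideal_plus_lclass lclass_plus_Meet lclass_plus_Join)
  show "iota entails (a + b) = ideal_plus (iota entails a) (iota entails b)" for a b
    by (simp add: iota_def ideal_plus_lclass)
qed

text \<open>Any admissible law obeys the recursion that defines \<open>lterm_plus\<close>: it is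
  addition on generators because \<open>iota\<close> is a morphism, compatibility distributes it
  over the second argument, and commutativity transfers this to the first. Since every element of
  \<open>H\<close> is the class of a term, the law is thereby determined.\<close>

lemma group_law_of_ideals_lclass:
  assumes p: "group_law_of_ideals entails p"
  shows "p (lclass entails s) (lclass entails t) = lclass entails (lterm_plus s t)"
proof -
  obtain e where "comm_group \<lparr>carrier = carrier H, monoid.mult = p, one = e\<rparr>"
    using p unfolding group_law_of_ideals_def group_law_on_def by blast
  then interpret p: comm_group "\<lparr>carrier = carrier H, monoid.mult = p, one = e\<rparr>" .
  have comm: "p (lclass entails u) (lclass entails v) = p (lclass entails v) (lclass entails u)" for u v
    using p.m_comm[of "lclass entails u" "lclass entails v"] by (simp add: lclass_closed)
  have meet: "p (lclass entails u) (lclass entails (Meet v w))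
      = p (lclass entails u) (lclass entails v) \<sqinter>\<^bsub>H\<^esub> p (lclass entails u) (lclass entails w)"
    and join: "p (lclass entails u) (lclass entails (Join v w))
      = p (lclass entails u) (lclass entails v) \<squnion>\<^bsub>H\<^esub> p (lclass entails u) (lclass entails w)" for u v w
    using p unfolding group_law_of_ideals_def compatible_law_def
    by (simp_all add: lclass_Meet lclass_Join lclass_closed)
  show ?thesis
  proof (induction s)
    case (Gen a)
    show ?case
    proof (induction t)
      case (Gen b)
      show ?case using p unfolding group_law_of_ideals_def iota_def by simp
    qed (simp_all add: meet join lclass_Meet[symmetric] lclass_Join[symmetric])
  next
    case (Meet s s')
    then show ?case
      by (simp add: comm[of "Meet s s'" t] meet comm[of t s] comm[of t s'] lclass_Meet[symmetric])
  next
    case (Join s s')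
    then show ?case
      by (simp add: comm[of "Join s s'" t] join comm[of t s] comm[of t s'] lclass_Join[symmetric])
  qed
qed

lemma group_law_of_ideals_unique:
  assumes "group_law_of_ideals entails p"
  shows "p = ideal_plus"
proof -
  have p: "p \<in> carrier H \<rightarrow>\<^sub>E carrier H \<rightarrow>\<^sub>E carrier H"
    and ip: "ideal_plus \<in> carrier H \<rightarrow>\<^sub>E carrier H \<rightarrow>\<^sub>E carrier H"
    using assms group_law_of_ideals_ideal_plus
    unfolding group_law_of_ideals_def group_law_on_def by blast+
  show ?thesis
  proof (rule PiE_ext[OF p ip])
    fix x assume x: "x \<in> carrier H"
    show "p x = ideal_plus x"
    proof (rule PiE_ext[OF PiE_mem[OF p x] PiE_mem[OF ip x]])
      show "p x y = ideal_plus x y" if "y \<in> carrier H" for y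
        using that x group_law_of_ideals_lclass[OF assms]
        by (auto simp: carrier_generated_lattice ideal_plus_lclass)
    qed
  qed
qed

lemma lattice_ordered_group_ideal_plus: "lattice_ordered_group H ideal_plus"
proof -
  have "group_law_on (carrier H) ideal_plus"
    using group_law_of_ideals_ideal_plus by (simp add: group_law_of_ideals_def)
  moreover have "ideal_plus x z \<sqsubseteq>\<^bsub>H\<^esub> ideal_plus y z"
    if "x \<in> carrier H" "y \<in> carrier H" "z \<in> carrier H" "x \<sqsubseteq>\<^bsub>H\<^esub> y" for x y z
    using that unfolding carrier_generated_lattice
    by (auto simp: ideal_plus_lclass lclass_le_iff intro: lterm_plus_mono[OF _ lterm_le.le_refl])
  ultimately show ?thesis
    unfolding lattice_ordered_group_def using lattice_generated_lattice by blast
qed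

end

theorem theorem3p4:
  fixes entails :: "'a::ordered_ab_group_add set \<Rightarrow> 'a set \<Rightarrow> bool"
  assumes "regular_entailment entails"
  shows "(\<exists>!p. group_law_of_ideals entails p) \<and>
    (\<forall>p. group_law_of_ideals entails p \<longrightarrow> lattice_ordered_group (generated_lattice entails) p)"
proof -
  interpret regular_entailment entails by (rule assms)
  show ?thesis
    using group_law_of_ideals_ideal_plus group_law_of_ideals_unique lattice_ordered_group_ideal_plus
    by blast
qed

end
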